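(* Fix $p \in (0,1)$. Then, as $n \to \infty$, \[ \mathcal{E}_p(S_n) \le \Big(\frac{1+\sqrt{1-p}}{p}\Big) n + o_p(n). \]
   Context: For $\sigma\in S_n$, $i\in[n-1]$ is a descent if $\sigma(i)>\sigma(i+1)$; $\mathrm{Des}(\sigma)$ is the set of descents. For $T\subseteq \mathrm{Des}(\sigma)$, the Ungar move associated to $T$ reverses every descent in $T$, where maximal runs of consecutive indices in $T$ are treated as blocks that are reversed (e.g. for $\sigma=416523$, $T=\{3,4\}$ gives $412563$). Equivalently, viewing $S_n$ as a lattice under the right weak order, it sends $\sigma$ to the meet of $\sigma$ together with the elements $\sigma\circ(i\ i{+}1)$, $i\in T$. A random Ungar move with parameter $p$ includes each descent in $T$ independently with probability $p$ and applies the associated Ungar move; the Ungarian Markov chain on $S_n$ is the Markov chain whose transitions are random Ungar moves. $\mathcal{E}_p(S_n)$ is the expected number of steps for this chain, started at the decreasing permutation $n(n-1)\cdots 1$, to reach the identity $12\cdots n$. The $o_p(n)$ term depends on $p$ and $n$ only. *)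

theory Defs
  imports Complex_Main "HOL-Combinatorics.Multiset_Permutations" "HOL-Library.Landau_Symbols"
    "HOL-Library.Extended_Nonnegative_Real"
begin

text \<open>Permutations of [n] are represented in one-line notation as lists
  sigma = [sigma(1), ..., sigma(n)] containing each of the values 1..n exactly once.
  Descents are 1-based: i is a descent iff 1 <= i < n and sigma(i) > sigma(i+1).\<close>

definition perms :: "nat \<Rightarrow> nat list set" where
  "perms n = permutations_of_set {1..n}"

definition descents :: "nat list \<Rightarrow> nat set" where
  "descents xs = {i. 1 \<le> i \<and> i < length xs \<and> xs ! (i - 1) > xs ! i}"

text \<open>ungar_aux xs fs: fs ! j = True means the adjacent pair at 0-based positions j, j+1
  is selected. Maximal runs of selected consecutive pairs form blocks which are reversed.\<close>

fun ungar_aux :: "nat list \<Rightarrow> bool list \<Rightarrow> nat list" where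
  "ungar_aux [] fs = []"
| "ungar_aux (x # xs) fs =
     (let k = length (takeWhile id fs)
      in rev (take (Suc k) (x # xs)) @ ungar_aux (drop k xs) (drop (Suc k) fs))"

definition ungar_move :: "nat list \<Rightarrow> nat set \<Rightarrow> nat list" where
  "ungar_move xs T = ungar_aux xs (map (\<lambda>j. Suc j \<in> T) [0..<length xs - 1])"

definition ungar_trans :: "real \<Rightarrow> nat list \<Rightarrow> nat list \<Rightarrow> real" where
  "ungar_trans p sigma tau =
     (\<Sum>T\<in>Pow (descents sigma).
        if ungar_move sigma T = tau
        then p ^ card T * (1 - p) ^ (card (descents sigma) - card T) else 0)"

fun ungar_dist :: "real \<Rightarrow> nat \<Rightarrow> nat \<Rightarrow> nat list \<Rightarrow> real" where
  "ungar_dist p n 0 tau = (if tau = rev [1..<Suc n] then 1 else 0)"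
| "ungar_dist p n (Suc k) tau =
     (\<Sum>sigma\<in>perms n. ungar_dist p n k sigma * ungar_trans p sigma tau)"

text \<open>Expected hitting time of the identity: sum over k of P(X_k is not the identity),
  i.e. the sum over k of P(hitting time > k) (the identity is absorbing). Valued in ennreal.\<close>
definition expected_ungar_time :: "real \<Rightarrow> nat \<Rightarrow> ennreal" where
  "expected_ungar_time p n =
     (\<Sum>k. ennreal (\<Sum>sigma\<in>perms n - {[1..<Suc n]}. ungar_dist p n k sigma))"

lemma "ungar_move [4,1,6,5,2,3] {3,4} = [4,1,2,5,6,3]"
  by (simp add: ungar_move_def)

end

theory Submission
  imports Defs "HOL-Probability.Probability"
begin

text \<open>Fix a threshold \<open>k\<close> and call the entries at most \<open>k\<close> customers and the \<open>m = n - k\<close> others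
  servers. A customer standing immediately to the right of a server forms a descent with it, so it
  passes the server with probability at least \<open>p\<close>: the customers run through \<open>m\<close> discrete-time
  queues in tandem, and the longer reversals of an Ungar move only help them. Put
  \<open>s = sqrt (1 - p)\<close>. By Burke's theorem the tandem with Bernoulli arrivals of rate \<open>1 - s\<close> has a
  stationary product law, with queues of mean length 1, under which the departures are again
  independent with rate \<open>1 - s\<close>. The permutation is coupled to be ahead of this
  stationary tandem with a handicap \<open>S\<close>, as long as at most \<open>S\<close> customers are queueing
  initially; for \<open>S\<close> slightly above \<open>m\<close> this has probability bounded below by Markov's inequality.
  Hence all \<open>k\<close> customers are through as soon as the tandem has had \<open>k + S\<close> departures, which is
  about \<open>n\<close>, and up to exponentially small errors this takes \<open>n / (1 - s)\<close> steps, whatever \<open>k\<close> is.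
  A union bound over the thresholds finishes the proof.\<close>

section \<open>Prefix counts under Ungar moves\<close>

definition small_count :: "nat \<Rightarrow> nat list \<Rightarrow> nat \<Rightarrow> nat" where
  "small_count k xs i = length (filter (\<lambda>v. v \<le> k) (take i xs))"

lemma small_count_append:
  "small_count k (xs @ ys) i = small_count k xs i + small_count k ys (i - length xs)"
  by (simp add: small_count_def)

lemma small_count_le_index: "small_count k xs i \<le> i"
  unfolding small_count_def by (metis length_filter_le length_take min.bounded_iff order_trans)

lemma small_count_Suc:
  "small_count k xs (Suc i) = small_count k xs i + of_bool (i < length xs \<and> xs ! i \<le> k)"
  by (cases "i < length xs") (simp_all add: small_count_def take_Suc_conv_app_nth)

lemma small_count_mono: "i \<le> j \<Longrightarrow> small_count k xs i \<le> small_count k xs j"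
  by (rule lift_Suc_mono_le[of "small_count k xs"]) (simp_all add: small_count_Suc)

lemma small_count_sorted:
  assumes "sorted xs"
  shows "small_count k xs i = min i (length (filter (\<lambda>v. v \<le> k) xs))"
  using assms
proof (induction xs arbitrary: i)
  case Nil
  then show ?case by (simp add: small_count_def)
next
  case (Cons x xs)
  show ?case
  proof (cases i)
    case 0
    then show ?thesis by (simp add: small_count_def)
  next
    case (Suc j)
    have "filter (\<lambda>v. v \<le> k) xs = []" if "\<not> x \<le> k"
      using Cons.prems that by (auto simp: filter_empty_conv)
    then show ?thesis
      using Suc Cons.IH[of j] Cons.prems by (auto simp: small_count_def)
  qed
qed

text \<open>Reversal sorts a decreasing block, and a sorted block has the largest possible count,
  the minimum of \<open>i\<close> and the number of small entries. In the strict case a large entry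
  lies among the first \<open>i\<close> and a small one behind them, so the old count stays below
  both.\<close>

lemma small_count_rev_decreasing:
  assumes "sorted (rev ys)"
  shows "small_count k ys i \<le> small_count k (rev ys) i"
    and "1 \<le> i \<Longrightarrow> i < length ys \<Longrightarrow> k < ys ! (i - 1) \<Longrightarrow> ys ! i \<le> k \<Longrightarrow>
           small_count k ys i < small_count k (rev ys) i"
proof -
  have total: "small_count k ys (length ys) = length (filter (\<lambda>v. v \<le> k) ys)"
    by (simp add: small_count_def)
  have eq: "small_count k (rev ys) i = min i (small_count k ys (length ys))"
    using small_count_sorted[OF assms, of k i] total by (simp add: rev_filter[symmetric])
  have "small_count k ys i \<le> small_count k ys (length ys)"
    using small_count_mono[of i "length ys" k ys]
    by (cases "i \<le> length ys") (auto simp: small_count_def)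
  then show "small_count k ys i \<le> small_count k (rev ys) i"
    using eq small_count_le_index by simp
  assume i: "1 \<le> i" "i < length ys" "k < ys ! (i - 1)" "ys ! i \<le> k"
  have "small_count k ys i \<le> i - 1"
    using i small_count_Suc[of k ys "i - 1"] small_count_le_index[of k ys "i - 1"] by simp
  moreover have "small_count k ys i < small_count k ys (length ys)"
    using i small_count_Suc[of k ys i] small_count_mono[of "Suc i" "length ys" k ys] by simp
  ultimately show "small_count k ys i < small_count k (rev ys) i"
    using eq i by simp
qed

lemma mset_ungar_aux [simp]: "mset (ungar_aux xs fs) = mset xs"
proof (induction xs fs rule: ungar_aux.induct)
  case (2 x xs fs)
  have "mset (take k xs) + mset (drop k xs) = mset xs" for k
    by (metis append_take_drop_id mset_append)
  then show ?case
    using 2[OF refl] by (simp add: Let_def)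
qed simp

text \<open>Induction over the blocks. Each block is decreasing, because its inner pairs are
  selected and hence descents, so reversing it cannot lower a count. A selected pair always lies
  inside a block, where the strict case applies.\<close>

lemma small_count_ungar_aux:
  assumes "length fs = length xs - 1"
    and "\<And>j. j < length fs \<Longrightarrow> fs ! j \<Longrightarrow> xs ! Suc j < xs ! j"
  shows "small_count k xs i \<le> small_count k (ungar_aux xs fs) i"
    and "1 \<le> i \<Longrightarrow> i < length xs \<Longrightarrow> fs ! (i - 1) \<Longrightarrow> k < xs ! (i - 1) \<Longrightarrow> xs ! i \<le> k \<Longrightarrow>
           small_count k xs i < small_count k (ungar_aux xs fs) i"
proof -
  have "small_count k xs i \<le> small_count k (ungar_aux xs fs) i \<and>
    (1 \<le> i \<longrightarrow> i < length xs \<longrightarrow> fs ! (i - 1) \<longrightarrow> k < xs ! (i - 1) \<longrightarrow> xs ! i \<le> k \<longrightarrow>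
       small_count k xs i < small_count k (ungar_aux xs fs) i)"
    using assms
  proof (induction xs fs arbitrary: i rule: ungar_aux.induct)
    case (2 x xs fs)
    define K where "K = length (takeWhile id fs)"
    define ys where "ys = take (Suc K) (x # xs)"
    define zs where "zs = drop K xs"
    define gs where "gs = drop (Suc K) fs"
    have K: "K \<le> length xs"
      using "2.prems"(1) length_takeWhile_le[of id fs] by (simp add: K_def)
    have split: "x # xs = ys @ zs"
      by (simp add: ys_def zs_def)
    have len: "length ys = Suc K"
      using K by (simp add: ys_def)
    have res: "ungar_aux (x # xs) fs = rev ys @ ungar_aux zs gs"
      by (simp add: Let_def ys_def zs_def gs_def K_def)
    have run: "fs ! j" if "j < K" for j
      using that nth_mem[of j "takeWhile id fs"] set_takeWhileD[of "fs ! j" id fs]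
      by (simp add: K_def takeWhile_nth)
    have stop: "\<not> fs ! K" if "K < length fs"
      using that nth_length_takeWhile[of id fs] by (simp add: K_def)
    have "sorted_wrt (\<ge>) ys"
    proof -
      have "ys ! Suc j \<le> ys ! j" if "Suc j < length ys" for j
        using that len run[of j] "2.prems"(1) "2.prems"(2)[of j] K
        by (simp add: ys_def less_imp_le del: take_Suc_Cons)
      then show ?thesis
        by (simp add: sorted_wrt_iff_nth_Suc_transp transp_def)
    qed
    then have desc: "sorted (rev ys)"
      by (simp add: sorted_wrt_rev)
    have IH: "small_count k zs j \<le> small_count k (ungar_aux zs gs) j \<and>
      (1 \<le> j \<longrightarrow> j < length zs \<longrightarrow> gs ! (j - 1) \<longrightarrow> k < zs ! (j - 1) \<longrightarrow> zs ! j \<le> k \<longrightarrow>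
         small_count k zs j < small_count k (ungar_aux zs gs) j)" for j
      unfolding zs_def gs_def
    proof (rule "2.IH"[OF K_def])
      show "length (drop (Suc K) fs) = length (drop K xs) - 1"
        using "2.prems"(1) by simp
      fix j assume j: "j < length (drop (Suc K) fs)" "drop (Suc K) fs ! j"
      then show "drop K xs ! Suc j < drop K xs ! j"
        using "2.prems"(1) "2.prems"(2)[of "Suc (K + j)"] by simp
    qed
    note blk = small_count_rev_decreasing[OF desc, where k = k]
    have before: "small_count k (x # xs) i = small_count k ys i + small_count k zs (i - Suc K)"
      by (simp only: split small_count_append len)
    have after: "small_count k (ungar_aux (x # xs) fs) i
        = small_count k (rev ys) i + small_count k (ungar_aux zs gs) (i - Suc K)"
      by (simp only: res small_count_append len length_rev)
    have le: "small_count k (x # xs) i \<le> small_count k (ungar_aux (x # xs) fs) i"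
      unfolding before after using blk(1)[of i] IH[of "i - Suc K"] len
      by (simp add: add_mono)
    have less: "small_count k (x # xs) i < small_count k (ungar_aux (x # xs) fs) i"
      if i: "1 \<le> i" "i < length (x # xs)" "fs ! (i - 1)" "k < (x # xs) ! (i - 1)" "(x # xs) ! i \<le> k"
    proof -
      have ifs: "i - 1 < length fs"
        using i "2.prems"(1) by simp
      consider "i \<le> K" | "i = Suc K" | "Suc K < i" by linarith
      then show ?thesis
      proof cases
        case 1
        then have "small_count k ys i < small_count k (rev ys) i"
          using i len blk(2)[of i] by (simp add: split nth_append split: if_splits)
        then show ?thesis
          unfolding before after using IH[of "i - Suc K"] len by (simp add: add_less_le_mono)
      next
        \<comment> \<open>The pair would straddle the first block and the rest, but the flag that
          ends a maximal run is \<open>False\<close>.\<close>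
        case 2
        then show ?thesis
          using stop ifs i by simp
      next
        case 3
        then obtain l where l: "i = Suc (Suc (K + l))"
          using less_imp_Suc_add[of "Suc K" i] by auto
        have "small_count k zs (i - Suc K) < small_count k (ungar_aux zs gs) (i - Suc K)"
        proof -
          have "1 \<le> i - Suc K" "i - Suc K < length zs"
            using 3 i K by (auto simp: zs_def)
          moreover have "gs ! (i - Suc K - 1)" "k < zs ! (i - Suc K - 1)" "zs ! (i - Suc K) \<le> k"
            using i ifs len unfolding split by (simp_all add: l gs_def nth_append)
          ultimately show ?thesis
            using IH[of "i - Suc K"] by simp
        qed
        then show ?thesis
          unfolding before after using blk(1)[of i] len by (simp add: add_le_less_mono)
      qed
    qed
    show ?case
      using le less by blast
  qed (simp add: small_count_def)
  then show "small_count k xs i \<le> small_count k (ungar_aux xs fs) i"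
    and "1 \<le> i \<Longrightarrow> i < length xs \<Longrightarrow> fs ! (i - 1) \<Longrightarrow> k < xs ! (i - 1) \<Longrightarrow> xs ! i \<le> k \<Longrightarrow>
           small_count k xs i < small_count k (ungar_aux xs fs) i"
    by blast+
qed

section \<open>Ungar moves on permutations and recognition of the identity\<close>

lemma finite_descents [simp]: "finite (descents xs)"
  by (rule finite_subset[of _ "{..<length xs}"]) (auto simp: descents_def)

lemma ungar_move_in_perms: "xs \<in> perms n \<Longrightarrow> ungar_move xs T \<in> perms n"
  using mset_ungar_aux[of xs "map (\<lambda>j. Suc j \<in> T) [0..<length xs - 1]"]
  by (metis mset_eq_imp_distinct_iff mset_eq_setD perms_def permutations_of_setD
      permutations_of_setI ungar_move_def)

lemma small_count_ungar_move:
  assumes "T \<subseteq> descents xs"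
  shows "small_count k xs i \<le> small_count k (ungar_move xs T) i"
    and "i \<in> T \<Longrightarrow> k < xs ! (i - 1) \<Longrightarrow> xs ! i \<le> k \<Longrightarrow>
           small_count k xs i < small_count k (ungar_move xs T) i"
proof -
  let ?fs = "map (\<lambda>j. Suc j \<in> T) [0..<length xs - 1]"
  have 1: "length ?fs = length xs - 1"
    by simp
  have 2: "xs ! Suc j < xs ! j" if "j < length ?fs" "?fs ! j" for j
    using that assms by (auto simp: descents_def)
  note mv = small_count_ungar_aux[OF 1 2, where k = k and i = i]
  show "small_count k xs i \<le> small_count k (ungar_move xs T) i"
    using mv(1) by (simp add: ungar_move_def)
  assume i: "i \<in> T" "k < xs ! (i - 1)" "xs ! i \<le> k"
  then have "1 \<le> i" "i < length xs"
    using assms by (auto simp: descents_def)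
  then show "small_count k xs i < small_count k (ungar_move xs T) i"
    using mv(2) i by (simp add: ungar_move_def)
qed

text \<open>Only \<open>k - v\<close> places follow the first \<open>n - k + v\<close>, so at least
  \<open>v\<close> of the \<open>k\<close> small entries lie among the latter. In the coupling this
  makes the condition on the arrival stream hold for free.\<close>

lemma small_count_perms_ge:
  assumes "xs \<in> perms n" "k \<le> n" "v \<le> k"
  shows "v \<le> small_count k xs (n - k + v)"
proof -
  have xs: "set xs = {1..n}" "distinct xs"
    using assms(1) by (auto simp: perms_def dest: permutations_of_setD)
  have len: "length xs = n"
    using distinct_card[OF xs(2)] xs(1) by simp
  have "set (filter (\<lambda>v. v \<le> k) xs) = {1..k}"
    using xs assms(2) by auto
  then have "length (filter (\<lambda>v. v \<le> k) xs) = k"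
    using distinct_card[of "filter (\<lambda>v. v \<le> k) xs"] xs by simp
  then have "small_count k xs (n - k + v) + length (filter (\<lambda>v. v \<le> k) (drop (n - k + v) xs)) = k"
    by (simp add: small_count_def flip: length_append filter_append)
  moreover have "length (filter (\<lambda>v. v \<le> k) (drop (n - k + v) xs)) \<le> k - v"
    using length_filter_le[of "\<lambda>v. v \<le> k" "drop (n - k + v) xs"] len assms by simp
  ultimately show ?thesis
    using assms by linarith
qed

text \<open>If \<open>k\<close> of the first \<open>k\<close> entries are at most \<open>k\<close>,
  these entries are exactly \<open>{1..k}\<close>; successive prefixes then determine each entry.
  This is what permits a union bound over thresholds.\<close>

lemma perms_eq_identityI:
  assumes xs: "xs \<in> perms n" and sorted: "\<And>k. k < n \<Longrightarrow> k \<le> small_count k xs k"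
  shows "xs = [1..<Suc n]"
proof -
  have set: "set xs = {1..n}" "distinct xs"
    using xs by (auto simp: perms_def dest: permutations_of_setD)
  have len: "length xs = n"
    using distinct_card[OF set(2)] set(1) by simp
  have take: "set (take k xs) = {1..k}" if "k \<le> n" for k
  proof (cases "k = n")
    case True
    then show ?thesis using set len by simp
  next
    case False
    then have "length (take k xs) \<le> length (filter (\<lambda>v. v \<le> k) (take k xs))"
      using that sorted[of k] len by (simp add: small_count_def)
    then have "filter (\<lambda>v. v \<le> k) (take k xs) = take k xs"
      by (metis filter_id_conv length_filter_le le_antisym length_filter_less not_less)
    then have "\<forall>v\<in>set (take k xs). v \<le> k"
      by (simp add: filter_id_conv)
    then have "set (take k xs) \<subseteq> {1..k}"
      using set(1) set_take_subset[of k xs] by fastforce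
    moreover have "card (set (take k xs)) = card {1..k}"
      using set(2) len that by (simp add: distinct_card)
    ultimately show ?thesis
      by (intro card_subset_eq) auto
  qed
  have "xs ! i = Suc i" if "i < n" for i
  proof -
    have "insert (xs ! i) {1..i} = {1..Suc i}"
      using take[of i] take[of "Suc i"] that len by (simp add: take_Suc_conv_app_nth)
    moreover have "xs ! i \<notin> {1..i}"
    proof -
      have "distinct (take (Suc i) xs)"
        using set(2) by simp
      then show ?thesis
        using take[of i] that len by (simp add: take_Suc_conv_app_nth)
    qed
    ultimately have "xs ! i \<in> {1..Suc i} - {1..i}"
      by blast
    then show ?thesis
      by auto
  qed
  then show ?thesis
    using len by (intro nth_equalityI) (auto simp del: upt_Suc)
qed

section \<open>Stationary queues in tandem\<close>

text \<open>In each time step a busy server releases one customer with probability \<open>1 - s\<^sup>2\<close>, and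
  a new customer arrives with probability \<open>1 - s\<close>. The stationary law of the queue length has
  mean 1 for exactly this arrival rate; this is what makes the bound independent of the
  threshold \<open>k\<close>.\<close>

definition queue_pmf :: "real \<Rightarrow> nat pmf" where
  "queue_pmf s = bind_pmf (bernoulli_pmf (1 / (1 + s)))
     (\<lambda>b. if b then map_pmf Suc (geometric_pmf (1 / (1 + s))) else return_pmf 0)"

lemma pmf_queue_0:
  assumes "0 < s"
  shows "pmf (queue_pmf s) 0 = s / (1 + s)"
proof -
  have "pmf (map_pmf Suc M) 0 = 0" for M
    by (simp add: pmf_eq_0_set_pmf)
  then show ?thesis
    using assms by (simp add: queue_pmf_def pmf_bind field_simps)
qed

lemma pmf_queue_Suc:
  assumes "0 < s"
  shows "pmf (queue_pmf s) (Suc j) = (s / (1 + s)) ^ j * (1 / (1 + s))\<^sup>2"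
proof -
  have "1 - 1 / (1 + s) = s / (1 + s)"
    using assms by (simp add: field_simps)
  then show ?thesis
    using assms
    by (simp add: queue_pmf_def pmf_bind pmf_map_inj' power2_eq_square)
qed

text \<open>The geometric part has mean \<open>s\<close>, so the nonzero branch has mean
  \<open>1 + s\<close> and is taken with probability \<open>1 / (1 + s)\<close>.\<close>

lemma nn_integral_queue_pmf:
  assumes "0 < s"
  shows "(\<integral>\<^sup>+q. of_nat q \<partial>queue_pmf s) = 1"
proof -
  let ?g = "1 / (1 + s)"
  have g: "?g \<in> {0<..1}"
    using assms by auto
  have "(\<integral>\<^sup>+q. of_nat q \<partial>geometric_pmf ?g) = ennreal ((1 - ?g) / ?g)"
    using expectation_geometric_pmf[OF g] integrable_real_geometric_pmf[OF g]
    by (simp add: ennreal_of_nat_eq_real_of_nat nn_integral_eq_integral)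
  moreover have "(1 - ?g) / ?g = s"
    using assms by (simp add: field_simps)
  ultimately have "(\<integral>\<^sup>+q. of_nat q \<partial>queue_pmf s) = (1 + ennreal s) * ennreal ?g"
    using assms by (simp add: queue_pmf_def nn_integral_add)
  also have "\<dots> = 1"
    using assms by (simp flip: ennreal_1 ennreal_plus ennreal_mult)
  finally show ?thesis .
qed

text \<open>Service is decided on the queue before the arrival joins it, so no customer passes two
  servers within one step.\<close>

definition serve :: "bool \<Rightarrow> nat \<Rightarrow> bool \<Rightarrow> bool \<times> nat" where
  "serve a q c = (c \<and> 0 < q, q - of_bool (c \<and> 0 < q) + of_bool a)"

text \<open>Burke's theorem for one time step: the departure is independent of the new queue length
  and distributed like the arrival.\<close>

lemma serve_stationary:
  assumes s: "0 < s" "s < 1"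
  shows "bind_pmf (bernoulli_pmf (1 - s)) (\<lambda>a. bind_pmf (bernoulli_pmf (1 - s\<^sup>2))
           (\<lambda>c. map_pmf (\<lambda>q. serve a q c) (queue_pmf s)))
         = pair_pmf (bernoulli_pmf (1 - s)) (queue_pmf s)"
proof (rule pmf_eqI, clarify)
  fix d j
  have p: "0 \<le> 1 - s\<^sup>2" "1 - s\<^sup>2 \<le> 1"
    using s by (auto simp: power_le_one)
  have single: "measure (queue_pmf s) {i} = pmf (queue_pmf s) i" for i
    by (rule measure_pmf_single)
  have serve_simps: "serve a 0 c = (False, of_bool a)"
    "serve a (Suc q) c = (c, q + of_bool (\<not> c) + of_bool a)" for a q c
    by (auto simp: serve_def)
  \<comment> \<open>The preimages of \<open>(d, j)\<close> for the four values of arrival and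
    service bit reduce the left-hand side to finitely many terms.\<close>
  have 1: "(\<lambda>q. serve True q True) -` {(d, j)} = (if d then {j} - {0} else if j = 1 then {0} else {})"
    by (rule set_eqI, rename_tac q, case_tac q) (auto simp: serve_simps)
  have 2: "(\<lambda>q. serve True q False) -` {(d, j)} = (if d \<or> j = 0 then {} else {j - 1})"
    by (rule set_eqI, rename_tac q, case_tac q) (auto simp: serve_simps)
  have 3: "(\<lambda>q. serve False q True) -` {(d, j)} = (if d then {Suc j} else if j = 0 then {0} else {})"
    by (rule set_eqI, rename_tac q, case_tac q) (auto simp: serve_simps)
  have 4: "(\<lambda>q. serve False q False) -` {(d, j)} = (if d then {} else {j})"
    by (rule set_eqI, rename_tac q, case_tac q) (auto simp: serve_simps)
  let ?\<pi> = "pmf (queue_pmf s)"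
  have lhs: "pmf (bind_pmf (bernoulli_pmf (1 - s)) (\<lambda>a. bind_pmf (bernoulli_pmf (1 - s\<^sup>2))
           (\<lambda>c. map_pmf (\<lambda>q. serve a q c) (queue_pmf s)))) (d, j)
      = (if d then (1 - s) * (1 - s\<^sup>2) * (if j = 0 then 0 else ?\<pi> j) + s * (1 - s\<^sup>2) * ?\<pi> (Suc j)
         else (1 - s) * (1 - s\<^sup>2) * (if j = 1 then ?\<pi> 0 else 0)
           + (1 - s) * s\<^sup>2 * (if j = 0 then 0 else ?\<pi> (j - 1))
           + s * (1 - s\<^sup>2) * (if j = 0 then ?\<pi> 0 else 0) + s * s\<^sup>2 * ?\<pi> j)"
    using s p by (simp add: pmf_bind pmf_map 1 2 3 4 single algebra_simps)
  have rhs: "pmf (pair_pmf (bernoulli_pmf (1 - s)) (queue_pmf s)) (d, j) = (if d then 1 - s else s) * ?\<pi> j"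
    using s by (cases d) (simp_all add: pmf_pair)
  \<comment> \<open>\<open>r\<close> is the ratio of the geometric tail. The identities
    \<open>K1\<close> to \<open>K3\<close> derived from it are the balance equations used in the
    cases below.\<close>
  define r where "r = s / (1 + s)"
  have r: "?\<pi> 0 = r" "?\<pi> (Suc i) = r ^ i * (1 - r)\<^sup>2" for i
    using s by (simp_all add: pmf_queue_0 pmf_queue_Suc r_def field_simps)
  have s_eq: "s * (1 - r) = r" "(1 + s) * (1 - r) = 1" "(1 + s) * r = s"
    using s by (simp_all add: r_def field_simps)
  have "s * (1 - s\<^sup>2) * (1 - r)\<^sup>2 = (1 - s) * ((1 + s) * (1 - r)) * (s * (1 - r))"
    by (simp add: power2_eq_square algebra_simps)
  then have K1: "s * (1 - s\<^sup>2) * (1 - r)\<^sup>2 = (1 - s) * r"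
    by (simp only: s_eq; simp)
  have "(1 - s) * (1 - s\<^sup>2) + s * (1 - s\<^sup>2) * r = (1 - s) * (1 - s\<^sup>2 + s * ((1 + s) * r))"
    by (simp add: power2_eq_square algebra_simps)
  then have K2: "(1 - s) * (1 - s\<^sup>2) + s * (1 - s\<^sup>2) * r = 1 - s"
    by (simp only: s_eq) (simp add: power2_eq_square)
  have "(1 - s) * s\<^sup>2 + s * s\<^sup>2 * r = s * r + (1 - s) * s * (s - (1 + s) * r)"
    by (simp add: power2_eq_square algebra_simps)
  then have K3: "(1 - s) * s\<^sup>2 + s * s\<^sup>2 * r = s * r"
    by (simp only: s_eq; simp)
  consider "j = 0" | "j = 1" | i where "j = Suc (Suc i)"
    by (metis One_nat_def not0_implies_Suc)
  then have "(if d then (1 - s) * (1 - s\<^sup>2) * (if j = 0 then 0 else ?\<pi> j) + s * (1 - s\<^sup>2) * ?\<pi> (Suc j)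
         else (1 - s) * (1 - s\<^sup>2) * (if j = 1 then ?\<pi> 0 else 0)
           + (1 - s) * s\<^sup>2 * (if j = 0 then 0 else ?\<pi> (j - 1))
           + s * (1 - s\<^sup>2) * (if j = 0 then ?\<pi> 0 else 0) + s * s\<^sup>2 * ?\<pi> j)
      = (if d then 1 - s else s) * ?\<pi> j"
  proof cases
    case 1
    have "s * (1 - s\<^sup>2) * r + s * s\<^sup>2 * r = s * r"
      by (simp add: algebra_simps)
    then show ?thesis
      using K1 by (simp add: 1 r)
  next
    case 2
    have "(1 - s) * (1 - s\<^sup>2) * X + s * (1 - s\<^sup>2) * (r * X) = (1 - s) * X" for X
      using K2 by algebra
    moreover have "(1 - s) * (1 - s\<^sup>2) * r + (1 - s) * s\<^sup>2 * r + s * s\<^sup>2 * (1 - r)\<^sup>2 = s * (1 - r)\<^sup>2"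
      using K1 by algebra
    ultimately show ?thesis
      by (simp add: 2 r)
  next
    case 3
    have "(1 - s) * (1 - s\<^sup>2) * (r * X) + s * (1 - s\<^sup>2) * (r * (r * X)) = (1 - s) * (r * X)"
      "(1 - s) * s\<^sup>2 * X + s * s\<^sup>2 * (r * X) = s * (r * X)" for X
      using K2 K3 by algebra+
    then show ?thesis
      by (simp add: 3 r mult.assoc)
  qed
  then show "pmf (bind_pmf (bernoulli_pmf (1 - s)) (\<lambda>a. bind_pmf (bernoulli_pmf (1 - s\<^sup>2))
           (\<lambda>c. map_pmf (\<lambda>q. serve a q c) (queue_pmf s)))) (d, j)
      = pmf (pair_pmf (bernoulli_pmf (1 - s)) (queue_pmf s)) (d, j)"
    unfolding lhs rhs .
qed

fun tandem :: "bool \<Rightarrow> nat list \<Rightarrow> bool list \<Rightarrow> bool \<times> nat list" where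
  "tandem a (q # qs) (c # cs) =
     (let (d, q') = serve a q c; (e, qs') = tandem d qs cs in (e, q' # qs'))"
| "tandem a _ _ = (a, [])"

text \<open>Induction along the tandem: the first server hands on a Bernoulli bit that is
  independent of its new queue, so this queue can be set aside and the bit acts as the arrival for
  the remaining servers.\<close>

lemma tandem_stationary:
  assumes s: "0 < s" "s < 1"
  shows "bind_pmf (bernoulli_pmf (1 - s)) (\<lambda>a. bind_pmf (replicate_pmf m (queue_pmf s))
           (\<lambda>qs. map_pmf (tandem a qs) (replicate_pmf m (bernoulli_pmf (1 - s\<^sup>2)))))
         = pair_pmf (bernoulli_pmf (1 - s)) (replicate_pmf m (queue_pmf s))"
proof (induction m)
  case 0
  then show ?case
    by (simp add: map_pmf_def bind_return_pmf pair_pmf_def bind_assoc_pmf)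
next
  case (Suc m)
  let ?A = "bernoulli_pmf (1 - s)" and ?Q = "queue_pmf s" and ?C = "bernoulli_pmf (1 - s\<^sup>2)"
  let ?Qs = "replicate_pmf m ?Q" and ?Cs = "replicate_pmf m ?C"
  have "bind_pmf ?A (\<lambda>a. bind_pmf (replicate_pmf (Suc m) ?Q)
           (\<lambda>qs. map_pmf (tandem a qs) (replicate_pmf (Suc m) ?C)))
      = bind_pmf ?A (\<lambda>a. bind_pmf ?Q (\<lambda>q. bind_pmf ?Qs (\<lambda>qs. bind_pmf ?C (\<lambda>c. bind_pmf ?Cs
          (\<lambda>cs. return_pmf (tandem a (q # qs) (c # cs)))))))"
    by (simp add: map_pmf_def bind_assoc_pmf bind_return_pmf)
  \<comment> \<open>By independence the coin of the first server can be drawn next to its queue,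
    where \<open>serve_stationary\<close> applies.\<close>
  also have "\<dots> = bind_pmf ?A (\<lambda>a. bind_pmf ?C (\<lambda>c. bind_pmf ?Q (\<lambda>q. bind_pmf ?Qs (\<lambda>qs. bind_pmf ?Cs
          (\<lambda>cs. return_pmf (tandem a (q # qs) (c # cs)))))))"
    by (subst bind_commute_pmf[of ?Qs ?C], subst bind_commute_pmf[of ?Q ?C]) rule
  also have "\<dots> = bind_pmf (bind_pmf ?A (\<lambda>a. bind_pmf ?C (\<lambda>c. map_pmf (\<lambda>q. serve a q c) ?Q)))
      (\<lambda>(d, q'). bind_pmf ?Qs (\<lambda>qs. bind_pmf ?Cs
          (\<lambda>cs. return_pmf (let (e, qs') = tandem d qs cs in (e, q' # qs')))))"
    by (simp add: map_pmf_def bind_assoc_pmf bind_return_pmf case_prod_unfold Let_def)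
  also have "\<dots> = bind_pmf (pair_pmf ?A ?Q)
      (\<lambda>(d, q'). bind_pmf ?Qs (\<lambda>qs. bind_pmf ?Cs
          (\<lambda>cs. return_pmf (let (e, qs') = tandem d qs cs in (e, q' # qs')))))"
    by (simp only: serve_stationary[OF s])
  also have "\<dots> = bind_pmf ?Q (\<lambda>q'. map_pmf (\<lambda>(e, qs'). (e, q' # qs'))
      (bind_pmf ?A (\<lambda>a. bind_pmf ?Qs (\<lambda>qs. map_pmf (tandem a qs) ?Cs))))"
    unfolding pair_pmf_def map_pmf_def bind_assoc_pmf bind_return_pmf
    by (subst bind_commute_pmf[of ?A ?Q]) (simp add: bind_assoc_pmf bind_return_pmf case_prod_unfold Let_def)
  also have "\<dots> = bind_pmf ?Q (\<lambda>q'. map_pmf (\<lambda>(e, qs'). (e, q' # qs')) (pair_pmf ?A ?Qs))"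
    by (simp only: Suc.IH)
  also have "\<dots> = pair_pmf ?A (replicate_pmf (Suc m) ?Q)"
    unfolding pair_pmf_def map_pmf_def bind_assoc_pmf bind_return_pmf
    by (subst bind_commute_pmf[of ?Q ?A]) (simp add: bind_assoc_pmf bind_return_pmf)
  finally show ?case .
qed

text \<open>The expectation of \<open>x\<close> to the power of \<open>D\<close> plus the number of
  departures from the last server in \<open>t\<close> further steps, started from the queues
  \<open>qs\<close>. The recursion replaces a space of trajectories.\<close>

fun departure_gf :: "real \<Rightarrow> real \<Rightarrow> nat \<Rightarrow> nat \<Rightarrow> nat list \<Rightarrow> ennreal" where
  "departure_gf s x 0 D qs = ennreal (x ^ D)"
| "departure_gf s x (Suc t) D qs =
     (\<integral>\<^sup>+a. \<integral>\<^sup>+cs. (case tandem a qs cs of (d, qs') \<Rightarrow> departure_gf s x t (D + of_bool d) qs')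
        \<partial>replicate_pmf (length qs) (bernoulli_pmf (1 - s\<^sup>2)) \<partial>bernoulli_pmf (1 - s))"

text \<open>In stationarity the departure of each step is Bernoulli and independent of the new
  queues, which are stationary again; so every step contributes one factor
  \<open>s + (1 - s) * x\<close>.\<close>

lemma nn_integral_departure_gf:
  assumes s: "0 < s" "s < 1" and x: "0 \<le> x"
  shows "(\<integral>\<^sup>+qs. departure_gf s x t D qs \<partial>replicate_pmf m (queue_pmf s)) = ennreal (x ^ D * (s + (1 - s) * x) ^ t)"
proof (induction t arbitrary: D)
  case 0
  then show ?case by simp
next
  case (Suc t)
  let ?A = "bernoulli_pmf (1 - s)" and ?Qs = "replicate_pmf m (queue_pmf s)"
    and ?Cs = "replicate_pmf m (bernoulli_pmf (1 - s\<^sup>2))"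
  have "(\<integral>\<^sup>+qs. departure_gf s x (Suc t) D qs \<partial>?Qs)
      = (\<integral>\<^sup>+qs. (\<integral>\<^sup>+a. \<integral>\<^sup>+cs. (case tandem a qs cs of (d, qs') \<Rightarrow> departure_gf s x t (D + of_bool d) qs')
        \<partial>?Cs \<partial>?A) \<partial>?Qs)"
    by (intro nn_integral_cong_AE) (auto simp: AE_measure_pmf_iff set_replicate_pmf)
  also have "\<dots> = (\<integral>\<^sup>+r. (case r of (d, qs') \<Rightarrow> departure_gf s x t (D + of_bool d) qs')
      \<partial>bind_pmf ?Qs (\<lambda>qs. bind_pmf ?A (\<lambda>a. map_pmf (tandem a qs) ?Cs)))"
    by simp
  also have "bind_pmf ?Qs (\<lambda>qs. bind_pmf ?A (\<lambda>a. map_pmf (tandem a qs) ?Cs)) = pair_pmf ?A ?Qs"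
    using tandem_stationary[OF s] by (subst bind_commute_pmf)
  also have "(\<integral>\<^sup>+r. (case r of (d, qs') \<Rightarrow> departure_gf s x t (D + of_bool d) qs') \<partial>pair_pmf ?A ?Qs)
      = (\<integral>\<^sup>+d. ennreal (x ^ (D + of_bool d) * (s + (1 - s) * x) ^ t) \<partial>?A)"
    by (simp add: nn_integral_pair_pmf' Suc.IH)
  also have "\<dots> = ennreal (x ^ D * (s + (1 - s) * x) ^ Suc t)"
    using s x by (simp add: distrib_left distrib_right ac_simps flip: ennreal_plus ennreal_mult)
  finally show ?case .
qed

lemma nn_integral_sum_list_replicate_pmf:
  "(\<integral>\<^sup>+qs. of_nat (sum_list qs) \<partial>replicate_pmf m M) = of_nat m * (\<integral>\<^sup>+q. of_nat q \<partial>M)"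
  by (induction m) (simp_all add: nn_integral_add algebra_simps)

text \<open>Markov's inequality: the total queue length has mean \<open>m\<close>, so it is at least
  \<open>S + 1\<close> with probability at most \<open>m / (S + 1)\<close>, which is at most
  \<open>1 / (1 + e)\<close>.\<close>

lemma prob_sum_list_queue_ge:
  assumes "0 < s" "0 < e" and S: "(1 + e) * real m < real S + 1"
  shows "ennreal (e / (1 + e)) \<le> emeasure (replicate_pmf m (queue_pmf s)) {qs. sum_list qs \<le> S}"
proof -
  let ?M = "replicate_pmf m (queue_pmf s)"
  let ?B = "{qs. S < sum_list qs}"
  have "ennreal (real S + 1) * emeasure ?M ?B = (\<integral>\<^sup>+qs. ennreal (real S + 1) * indicator ?B qs \<partial>?M)"
    by (simp add: nn_integral_cmult_indicator)
  also have "\<dots> \<le> (\<integral>\<^sup>+qs. of_nat (sum_list qs) \<partial>?M)"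
    by (intro nn_integral_mono) (auto simp: indicator_def ennreal_of_nat_eq_real_of_nat
        simp del: ennreal_plus intro!: ennreal_leI)
  also have "\<dots> = ennreal (real m)"
    using assms by (simp add: nn_integral_sum_list_replicate_pmf nn_integral_queue_pmf
        flip: ennreal_of_nat_eq_real_of_nat)
  finally have "(real S + 1) * measure ?M ?B \<le> real m"
    by (simp add: measure_pmf.emeasure_eq_measure del: ennreal_plus flip: ennreal_mult)
  then have "(1 + e) * ((real S + 1) * measure ?M ?B) \<le> real S + 1"
    using S assms(2) mult_left_mono[of "(real S + 1) * measure ?M ?B" "real m" "1 + e"] by linarith
  then have "(real S + 1) * ((1 + e) * measure ?M ?B) \<le> (real S + 1) * 1"
    by (simp add: algebra_simps)
  then have "(1 + e) * measure ?M ?B \<le> 1"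
    by (subst (asm) mult_le_cancel_left_pos) auto
  then have "e / (1 + e) \<le> 1 - measure ?M ?B"
    using assms(2) by (simp add: field_simps)
  moreover have "measure ?M {qs. sum_list qs \<le> S} = 1 - measure ?M ?B"
    using measure_pmf.prob_compl[of ?B ?M] by (simp add: Compl_eq_Diff_UNIV[symmetric] Collect_neg_eq[symmetric] not_less)
  ultimately show ?thesis
    by (simp add: measure_pmf.emeasure_eq_measure ennreal_leI)
qed

section \<open>Coupling\<close>

text \<open>The expectation of \<open>f\<close> at a random subset of \<open>D\<close> that contains
  each element independently with probability \<open>p\<close>; the weights are those of
  \<open>ungar_trans\<close>.\<close>

definition coin_sum :: "real \<Rightarrow> nat set \<Rightarrow> (nat set \<Rightarrow> ennreal) \<Rightarrow> ennreal" where
  "coin_sum p D f = (\<Sum>T\<in>Pow D. ennreal (p ^ card T * (1 - p) ^ (card D - card T)) * f T)"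

lemma coin_sum_cong: "(\<And>T. T \<subseteq> D \<Longrightarrow> f T = g T) \<Longrightarrow> coin_sum p D f = coin_sum p D g"
  by (simp add: coin_sum_def)

lemma coin_sum_mono: "(\<And>T. T \<subseteq> D \<Longrightarrow> f T \<le> g T) \<Longrightarrow> coin_sum p D f \<le> coin_sum p D g"
  by (auto simp: coin_sum_def intro!: sum_mono mult_left_mono)

lemma coin_sum_cmult: "c * coin_sum p D f = coin_sum p D (\<lambda>T. c * f T)"
  by (simp add: coin_sum_def sum_distrib_left ac_simps)

lemma coin_sum_empty [simp]: "coin_sum p {} f = f {}"
  by (simp add: coin_sum_def)

lemma coin_sum_insert:
  assumes p: "0 \<le> p" "p \<le> 1" and D: "finite D" "x \<notin> D"
  shows "coin_sum p (insert x D) f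
    = ennreal p * coin_sum p D (\<lambda>T. f (insert x T)) + ennreal (1 - p) * coin_sum p D f"
proof -
  let ?w = "\<lambda>D T. ennreal (p ^ card T * (1 - p) ^ (card D - card T))"
  have inj: "inj_on (insert x) (Pow D)"
    using D(2) by (auto simp: inj_on_def)
  have in_w: "?w (insert x D) (insert x T) = ennreal p * ?w D T" if "T \<subseteq> D" for T
  proof -
    have "finite T" "x \<notin> T"
      using that D finite_subset by auto
    then show ?thesis
      using D p by (simp add: ac_simps flip: ennreal_mult)
  qed
  have out_w: "?w (insert x D) T = ennreal (1 - p) * ?w D T" if "T \<subseteq> D" for T
  proof -
    have "card T \<le> card D"
      using that D by (simp add: card_mono)
    then show ?thesis
      using D p by (simp add: Suc_diff_le ac_simps flip: ennreal_mult)
  qed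
  have "coin_sum p (insert x D) f
      = (\<Sum>T\<in>Pow D. ?w (insert x D) T * f T) + (\<Sum>T\<in>insert x ` Pow D. ?w (insert x D) T * f T)"
    unfolding coin_sum_def Pow_insert using D by (intro sum.union_disjoint) auto
  also have "(\<Sum>T\<in>insert x ` Pow D. ?w (insert x D) T * f T)
      = (\<Sum>T\<in>Pow D. ?w (insert x D) (insert x T) * f (insert x T))"
    by (simp only: sum.reindex[OF inj] o_def)
  also have "\<dots> = ennreal p * coin_sum p D (\<lambda>T. f (insert x T))"
    unfolding coin_sum_def sum_distrib_left by (intro sum.cong refl) (simp add: in_w ac_simps)
  also have "(\<Sum>T\<in>Pow D. ?w (insert x D) T * f T) = ennreal (1 - p) * coin_sum p D f"
    unfolding coin_sum_def sum_distrib_left by (intro sum.cong refl) (simp add: out_w ac_simps)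
  finally show ?thesis
    by (simp add: add.commute)
qed

text \<open>Coins outside \<open>D\<close> average out. Hence one common set of coins can drive two
  processes, each reading its own part of it.\<close>

lemma coin_sum_restrict:
  assumes p: "0 \<le> p" "p \<le> 1" and I: "finite I" "D \<subseteq> I"
  shows "coin_sum p I (\<lambda>C. f (C \<inter> D)) = coin_sum p D f"
proof -
  have "coin_sum p (D \<union> J) (\<lambda>C. f (C \<inter> D)) = coin_sum p D f" if "finite J" "J \<inter> D = {}" for J
    using that
  proof (induction J)
    case empty
    then show ?case
      by (auto intro!: coin_sum_cong arg_cong[where f = f])
  next
    case (insert x J)
    have 1: "coin_sum p (insert x (D \<union> J)) (\<lambda>C. f (C \<inter> D))
        = ennreal p * coin_sum p (D \<union> J) (\<lambda>C. f (insert x C \<inter> D))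
          + ennreal (1 - p) * coin_sum p (D \<union> J) (\<lambda>C. f (C \<inter> D))"
      using insert p I finite_subset by (intro coin_sum_insert) auto
    have 2: "insert x C \<inter> D = C \<inter> D" for C
      using insert by auto
    have "ennreal p * y + ennreal (1 - p) * y = y" for y
      using p by (simp flip: distrib_right ennreal_plus)
    then show ?case
      using 1 insert by (simp add: 2)
  qed
  from this[of "I - D"] show ?thesis
    using I by (simp add: Un_absorb1 finite_subset Int_commute)
qed

lemma coin_sum_image:
  assumes "inj_on g D"
  shows "coin_sum p (g ` D) f = coin_sum p D (\<lambda>T. f (g ` T))"
proof -
  have inj: "inj_on (image g) (Pow D)"
    using assms by (simp add: inj_on_image_Pow)
  have card: "card (g ` T) = card T" if "T \<subseteq> D" for T
    using that assms by (meson card_image inj_on_subset)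
  show ?thesis
    unfolding coin_sum_def image_Pow_surj[OF refl, symmetric] sum.reindex[OF inj]
    by (intro sum.cong) (auto simp: card)
qed

lemma coin_sum_replicate_pmf:
  assumes p: "0 \<le> p" "p \<le> 1" and "distinct is"
  shows "coin_sum p (set is) (\<lambda>C. F (map (\<lambda>i. i \<in> C) is))
    = (\<integral>\<^sup>+cs. F cs \<partial>replicate_pmf (length is) (bernoulli_pmf p))"
  using assms(3)
proof (induction "is" arbitrary: F)
  case Nil
  then show ?case by simp
next
  case (Cons i "is")
  have 1: "coin_sum p (set is) (\<lambda>C. F (map (\<lambda>j. j \<in> insert i C) (i # is)))
      = coin_sum p (set is) (\<lambda>C. F (True # map (\<lambda>j. j \<in> C) is))"
    using Cons.prems by (intro coin_sum_cong arg_cong[where f = F]) auto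
  have 2: "coin_sum p (set is) (\<lambda>C. F (map (\<lambda>j. j \<in> C) (i # is)))
      = coin_sum p (set is) (\<lambda>C. F (False # map (\<lambda>j. j \<in> C) is))"
    using Cons.prems by (intro coin_sum_cong arg_cong[where f = F]) auto
  have "coin_sum p (set (i # is)) (\<lambda>C. F (map (\<lambda>j. j \<in> C) (i # is)))
      = ennreal p * coin_sum p (set is) (\<lambda>C. F (True # map (\<lambda>j. j \<in> C) is))
        + ennreal (1 - p) * coin_sum p (set is) (\<lambda>C. F (False # map (\<lambda>j. j \<in> C) is))"
    unfolding list.set 1[symmetric] 2[symmetric] using Cons.prems p by (intro coin_sum_insert) auto
  then show ?case
    using Cons.prems p Cons.IH[of "\<lambda>cs. F (True # cs)"] Cons.IH[of "\<lambda>cs. F (False # cs)"]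
    by (simp add: mult.commute)
qed

text \<open>For a permutation of at least \<open>k\<close> entries, the probability that
  \<open>t\<close> moves leave an entry above \<open>k\<close> in the first \<open>k\<close> places.
  The recursion is on the first move, as in \<open>departure_gf\<close>, so that the two can be
  coupled step by step.\<close>

fun unsorted_prob :: "real \<Rightarrow> nat \<Rightarrow> nat \<Rightarrow> nat list \<Rightarrow> ennreal" where
  "unsorted_prob p k 0 xs = (if small_count k xs k < k then 1 else 0)"
| "unsorted_prob p k (Suc t) xs =
     coin_sum p (descents xs) (\<lambda>T. unsorted_prob p k t (ungar_move xs T))"

text \<open>\<open>Z\<close> is a prefix count \<open>small_count k xs\<close>. The entry above \<open>k\<close> that has exactly \<open>l\<close> such
  entries to its left plays the server with \<open>l\<close> servers behind it, and the condition says that at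
  least \<open>v = min k (h - S)\<close> small entries have passed it. Here \<open>h\<close> is the number of departures
  from the corresponding server in the tandem. The truncated subtraction of the handicap \<open>S\<close> is
  intended: a server with \<open>h \<le> S\<close> imposes no condition.\<close>

definition ahead :: "nat \<Rightarrow> nat \<Rightarrow> (nat \<Rightarrow> nat) \<Rightarrow> nat \<Rightarrow> nat \<Rightarrow> bool" where
  "ahead k S Z l h \<longleftrightarrow> min k (h - S) \<le> Z (l + min k (h - S))"

text \<open>A suffix \<open>qs\<close> of the tandem stands for the stream entering it:
  \<open>D + sum_list qs\<close> customers have left the server in front of it, those queueing in
  \<open>qs\<close> at the start included. For the whole list this is the arrival stream.\<close>

fun dominates :: "nat \<Rightarrow> nat \<Rightarrow> (nat \<Rightarrow> nat) \<Rightarrow> nat \<Rightarrow> nat list \<Rightarrow> bool" where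
  "dominates k S Z D [] = ahead k S Z 0 D"
| "dominates k S Z D (q # qs) =
     (ahead k S Z (length (q # qs)) (D + sum_list (q # qs)) \<and> dominates k S Z D qs)"

lemma dominates_imp_ahead:
  assumes "dominates k S Z D qs"
  shows "ahead k S Z (length qs) (D + sum_list qs)" "ahead k S Z 0 D"
  using assms by (induction qs) auto

text \<open>All values \<open>h\<close> are at most \<open>S\<close>, so the truncated subtraction
  makes every condition void.\<close>

lemma dominates_start: "sum_list qs \<le> S \<Longrightarrow> dominates k S Z 0 qs"
  by (induction qs) (auto simp: ahead_def)

text \<open>A server takes its coin from the place, shifted by \<open>S\<close>, at which the entry playing it stands
  when the permutation is exactly as far as the tandem. As these places are distinct, the coins
  of the servers are independent.\<close>

fun coin_index :: "nat \<Rightarrow> nat list \<Rightarrow> nat list" where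
  "coin_index D [] = []"
| "coin_index D (q # qs) = (length (q # qs) + D + sum_list qs) # coin_index D qs"

lemma length_coin_index [simp]: "length (coin_index D qs) = length qs"
  by (induction qs) auto

text \<open>The indices strictly decrease along the list: those of the tail are at most
  \<open>length qs + D + sum_list qs\<close>, and the head exceeds this by one.\<close>

lemma distinct_coin_index: "distinct (coin_index D qs)"
proof -
  have "i \<le> length qs + D + sum_list qs" if "i \<in> set (coin_index D qs)" for i and qs :: "nat list"
    using that by (induction qs) auto
  then show ?thesis
    by (induction qs) fastforce+
qed

lemma tandem_conservation:
  assumes "tandem a qs cs = (d, qs')" "length cs = length qs"
  shows "length qs' = length qs \<and> sum_list qs' + of_bool d = sum_list qs + of_bool a"
  using assms
proof (induction a qs cs arbitrary: d qs' rule: tandem.induct)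
  case (1 a q qs c cs)
  obtain e q' where serve: "serve a q c = (e, q')"
    by force
  obtain rest where rest: "tandem e qs cs = (d, rest)" "qs' = q' # rest"
    using "1.prems"(1) serve by (auto simp: Let_def split: prod.splits)
  have "q' + of_bool e = q + of_bool a"
    using serve by (auto simp: serve_def)
  then show ?case
    using "1.IH"[OF serve[symmetric] refl rest(1)] "1.prems"(2) rest(2) by simp
qed auto

text \<open>The cases \<open>h < S\<close> and \<open>k \<le> h - S\<close> demand nothing new. If
  the entry has been passed by one more customer than required, growth from \<open>Z\<close> to
  \<open>Z'\<close> suffices. Otherwise it stands exactly at the required place with a customer
  directly to its right, and \<open>jump\<close> lets that customer pass.\<close>

lemma ahead_after_service:
  assumes old: "ahead k S Z l h" and prev: "ahead k S Z (Suc l) (h + q)" and "0 < q"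
    and Zle: "\<And>i. Z i \<le> Z' i"
    and Zstep: "\<And>i. Z i \<le> Z (Suc i)" "\<And>i. Z (Suc i) \<le> Suc (Z i)"
    and jump: "\<And>i. i + S = Suc (l + h) \<Longrightarrow> 0 < i \<Longrightarrow> Z (i - 1) = Z i \<Longrightarrow> Z (Suc i) = Suc (Z i) \<Longrightarrow> Z i < Z' i"
  shows "ahead k S Z' l (Suc h)"
proof -
  consider "h < S" | "k \<le> h - S" | "S \<le> h" "h - S < k"
    by linarith
  then show ?thesis
  proof cases
    case 1
    then show ?thesis by (simp add: ahead_def)
  next
    case 2
    then show ?thesis
      using old Zle[of "l + k"] by (simp add: ahead_def min_def Suc_diff_le)
  next
    case 3
    define v where "v = h - S"
    have shift: "Z (i + j) \<le> Z i + j" for i j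
      by (induction j) (auto intro: order_trans[OF Zstep(2)])
    have v: "v \<le> Z (l + v)"
      using old 3 by (simp add: ahead_def v_def)
    \<comment> \<open>Since \<open>0 < q\<close>, the preceding server has released at least one
      customer more; the cap does no harm because \<open>v < k\<close>.\<close>
    have "Suc v \<le> min k (h + q - S)"
      using 3 \<open>0 < q\<close> by (auto simp: v_def)
    then obtain j where j: "min k (h + q - S) = Suc v + j"
      using le_Suc_ex by blast
    have "Suc v + j \<le> Z (Suc l + Suc v + j)"
      using prev unfolding ahead_def j by (simp add: ac_simps)
    then have next_v: "Suc v \<le> Z (Suc l + Suc v)"
      using shift[of "Suc l + Suc v" j] by linarith
    have "Suc v \<le> Z' (l + Suc v)"
    proof (cases "Suc v \<le> Z (l + Suc v)")
      case True
      then show ?thesis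
        using Zle order_trans by blast
    next
      case False
      \<comment> \<open>Counting from 1, entry \<open>l + Suc v\<close> is large and the next one
        small. This is the descent whose coin, shifted by \<open>S\<close>, has index
        \<open>l + Suc h\<close>.\<close>
      then have "Z (l + Suc v) = v" "Z (l + v) = v" "Z (Suc (l + Suc v)) = Suc v"
        using v next_v Zstep(1)[of "l + v"] Zstep(2)[of "l + Suc v"] by auto
      then show ?thesis
        using jump[of "l + Suc v"] 3 by (simp add: v_def)
    qed
    then show ?thesis
      using 3 by (simp add: ahead_def v_def Suc_diff_le)
  qed
qed

text \<open>Induction from the first server on: given the new condition on the stream into the head,
  its service yields the new condition on the stream into the tail. The old conditions suffice for
  this, as \<open>serve\<close> tests the queue before the arrival.\<close>

lemma dominates_tandem:
  assumes "dominates k S Z D qs"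
    and Zle: "\<And>i. Z i \<le> Z' i"
    and Zstep: "\<And>i. Z i \<le> Z (Suc i)" "\<And>i. Z (Suc i) \<le> Suc (Z i)"
    and jump: "\<And>i. i + S \<in> C \<Longrightarrow> 0 < i \<Longrightarrow> Z (i - 1) = Z i \<Longrightarrow> Z (Suc i) = Suc (Z i) \<Longrightarrow> Z i < Z' i"
    and "ahead k S Z' (length qs) (D + sum_list qs + of_bool a)"
    and "tandem a qs (map (\<lambda>i. i \<in> C) (coin_index D qs)) = (d, qs')"
  shows "dominates k S Z' (D + of_bool d) qs'"
  using assms(1,6,7)
proof (induction qs arbitrary: a d qs')
  case Nil
  then show ?case by simp
next
  case (Cons q qs)
  let ?c = "length (q # qs) + D + sum_list qs \<in> C"
  obtain e q' where serve: "serve a q ?c = (e, q')"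
    by force
  obtain rest where rest: "tandem e qs (map (\<lambda>i. i \<in> C) (coin_index D qs)) = (d, rest)" "qs' = q' # rest"
    using Cons.prems(3) serve by (auto simp: Let_def split: prod.splits)
  have e: "e \<longleftrightarrow> ?c \<and> 0 < q"
    using serve by (auto simp: serve_def)
  have dom: "dominates k S Z D qs" "ahead k S Z (Suc (length qs)) (D + sum_list qs + q)"
    using Cons.prems(1) by (simp_all add: ac_simps)
  have "ahead k S Z' (length qs) (D + sum_list qs + of_bool e)"
  proof (cases e)
    case True
    have "ahead k S Z' (length qs) (Suc (D + sum_list qs))"
    proof (rule ahead_after_service[OF dominates_imp_ahead(1)[OF dom(1)] dom(2) _ Zle Zstep])
      show "0 < q"
        using True e by simp
      fix i assume "i + S = Suc (length qs + (D + sum_list qs))" "0 < i" "Z (i - 1) = Z i" "Z (Suc i) = Suc (Z i)"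
      then show "Z i < Z' i"
        using True e by (intro jump) (simp_all add: ac_simps)
    qed
    then show ?thesis
      using True by simp
  next
    case False
    then show ?thesis
      using dominates_imp_ahead(1)[OF dom(1)] Zle order_trans by (fastforce simp: ahead_def)
  qed
  then have "dominates k S Z' (D + of_bool d) rest"
    using Cons.IH[OF dom(1) _ rest(1)] by blast
  \<comment> \<open>Conservation of customers identifies the condition at the new head with the
    assumed condition on the arrivals.\<close>
  moreover have "length qs' = length (q # qs)" "D + of_bool d + sum_list qs' = D + sum_list (q # qs) + of_bool a"
    using tandem_conservation[OF Cons.prems(3)] by auto
  ultimately show ?case
    using Cons.prems(2) rest(2) by (metis dominates.simps(2))
qed

text \<open>Permutation and tandem share their coins, and domination survives every joint step. At
  the end an unsorted threshold forces \<open>D \<le> k + S\<close>, whence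
  \<open>x ^ (k + S) \<le> x ^ D\<close>.\<close>

lemma unsorted_prob_le_departure_gf:
  assumes s: "0 < s" "s < 1" and x: "0 \<le> x" "x \<le> 1" and "k \<le> n"
    and "xs \<in> perms n" "length qs = n - k" "dominates k S (small_count k xs) D qs"
  shows "ennreal (x ^ (k + S)) * unsorted_prob (1 - s\<^sup>2) k t xs \<le> departure_gf s x t D qs"
  using assms(6-8)
proof (induction t arbitrary: xs qs D)
  case 0
  show ?case
  proof (cases "small_count k xs k < k")
    case True
    \<comment> \<open>More departures would make \<open>ahead\<close> at level 0 claim
      \<open>k\<close> small entries in the first \<open>k\<close> places.\<close>
    then have "D \<le> k + S"
      using dominates_imp_ahead(2)[OF "0.prems"(3)]
      by (cases "D \<le> k + S") (auto simp: ahead_def)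
    then show ?thesis
      using True x by (simp add: power_decreasing ennreal_leI)
  qed simp
next
  case (Suc t)
  let ?p = "1 - s\<^sup>2" and ?X = "ennreal (x ^ (k + S))" and ?Z = "small_count k xs"
  \<comment> \<open>Descent \<open>i\<close> reads coin \<open>i + S\<close>; the shift avoids
    negative indices for servers still covered by the handicap.\<close>
  let ?E = "(\<lambda>i. i + S) ` descents xs" and ?J = "set (coin_index D qs)"
  let ?T = "\<lambda>C. {i. i + S \<in> C}"
  define H where "H = (\<lambda>a cs. case tandem a qs cs of (d, qs') \<Rightarrow> departure_gf s x t (D + of_bool d) qs')"
  let ?H = "\<lambda>cs. \<integral>\<^sup>+a. H a cs \<partial>bernoulli_pmf (1 - s)"
  have p: "0 \<le> ?p" "?p \<le> 1"
    using s by (auto simp: power_le_one)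
  have step: "?X * unsorted_prob ?p k t (ungar_move xs (?T (C \<inter> ?E))) \<le> H a (map (\<lambda>i. i \<in> C) (coin_index D qs))"
    for C a
  proof -
    let ?M = "?T (C \<inter> ?E)"
    obtain d qs' where tandem: "tandem a qs (map (\<lambda>i. i \<in> C) (coin_index D qs)) = (d, qs')"
      by force
    have M: "?M \<subseteq> descents xs"
      by auto
    have perm: "ungar_move xs ?M \<in> perms n"
      using Suc.prems(1) by (rule ungar_move_in_perms)
    have "dominates k S (small_count k (ungar_move xs ?M)) (D + of_bool d) qs'"
    proof (rule dominates_tandem[OF Suc.prems(3) _ _ _ _ _ tandem])
      fix i
      show "?Z i \<le> small_count k (ungar_move xs ?M) i"
        by (rule small_count_ungar_move(1)[OF M])
      show "?Z i \<le> ?Z (Suc i)" "?Z (Suc i) \<le> Suc (?Z i)"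
        by (simp_all add: small_count_Suc)
      assume i: "i + S \<in> C" "0 < i" "?Z (i - 1) = ?Z i" "?Z (Suc i) = Suc (?Z i)"
      have "i < length xs" "xs ! i \<le> k"
        using i(4) by (auto simp: small_count_Suc of_bool_def split: if_splits)
      moreover from this have "k < xs ! (i - 1)"
        using i(2,3) small_count_Suc[of k xs "i - 1"]
        by (auto simp: of_bool_def split: if_splits)
      ultimately show "?Z i < small_count k (ungar_move xs ?M) i"
        using i(1,2) by (intro small_count_ungar_move(2)[OF M]) (auto simp: descents_def)
    next
      \<comment> \<open>At level \<open>n - k\<close> every permutation satisfies the condition,
        whether or not a customer arrives.\<close>
      show "ahead k S (small_count k (ungar_move xs ?M)) (length qs) (D + sum_list qs + of_bool a)"
        using small_count_perms_ge[OF perm \<open>k \<le> n\<close>] Suc.prems(2) by (simp add: ahead_def)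
    qed
    moreover have "length qs' = n - k"
      using tandem_conservation[OF tandem] Suc.prems(2) by simp
    ultimately show ?thesis
      using Suc.IH[OF perm] by (simp add: H_def tandem)
  qed
  have "?X * unsorted_prob ?p k (Suc t) xs
      = coin_sum ?p (descents xs) (\<lambda>T. ?X * unsorted_prob ?p k t (ungar_move xs T))"
    by (simp add: coin_sum_cmult)
  also have "\<dots> = coin_sum ?p ?E (\<lambda>C. ?X * unsorted_prob ?p k t (ungar_move xs (?T C)))"
    by (subst coin_sum_image) (auto simp: inj_on_def image_iff)
  \<comment> \<open>The coupling: the move reads the coins in \<open>?E\<close> and the tandem those
    in \<open>?J\<close>, with overlaps shared; neither marginal law changes.\<close>
  also have "\<dots> = coin_sum ?p (?J \<union> ?E) (\<lambda>C. ?X * unsorted_prob ?p k t (ungar_move xs (?T (C \<inter> ?E))))"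
    by (rule coin_sum_restrict[OF p, symmetric]) auto
  also have "\<dots> \<le> coin_sum ?p (?J \<union> ?E) (\<lambda>C. ?H (map (\<lambda>i. i \<in> C \<inter> ?J) (coin_index D qs)))"
  proof (rule coin_sum_mono)
    fix C
    let ?c = "?X * unsorted_prob ?p k t (ungar_move xs (?T (C \<inter> ?E)))"
    have "?c = (\<integral>\<^sup>+a. ?c \<partial>bernoulli_pmf (1 - s))"
      by (simp only: nn_integral_const measure_pmf.emeasure_space_1 mult_1_right)
    also have "\<dots> \<le> ?H (map (\<lambda>i. i \<in> C) (coin_index D qs))"
      by (intro nn_integral_mono step)
    also have "map (\<lambda>i. i \<in> C) (coin_index D qs) = map (\<lambda>i. i \<in> C \<inter> ?J) (coin_index D qs)"
      by simp
    finally show "?c \<le> ?H (map (\<lambda>i. i \<in> C \<inter> ?J) (coin_index D qs))" .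
  qed
  also have "\<dots> = coin_sum ?p ?J (\<lambda>C. ?H (map (\<lambda>i. i \<in> C) (coin_index D qs)))"
    by (rule coin_sum_restrict[OF p]) auto
  also have "\<dots> = (\<integral>\<^sup>+cs. ?H cs \<partial>replicate_pmf (length qs) (bernoulli_pmf ?p))"
    by (subst coin_sum_replicate_pmf[OF p distinct_coin_index]) simp
  also have "\<dots> = (\<integral>\<^sup>+a. (\<integral>\<^sup>+cs. H a cs \<partial>replicate_pmf (length qs) (bernoulli_pmf ?p)) \<partial>bernoulli_pmf (1 - s))"
    using s by (simp add: nn_integral_add nn_integral_multc)
  also have "\<dots> = departure_gf s x (Suc t) D qs"
    by (simp add: H_def)
  finally show ?case .
qed

text \<open>The preceding bound is averaged over stationary queues, keeping on the left only the
  starts with at most \<open>S\<close> customers.\<close>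

lemma unsorted_prob_bound:
  assumes s: "0 < s" "s < 1" and x: "0 \<le> x" "x \<le> 1" and e: "0 < e"
    and "k \<le> n" "xs \<in> perms n" and S: "(1 + e) * real (n - k) < real S + 1"
  shows "ennreal (x ^ (k + S) * (e / (1 + e))) * unsorted_prob (1 - s\<^sup>2) k t xs
    \<le> ennreal ((s + (1 - s) * x) ^ t)"
proof -
  let ?M = "replicate_pmf (n - k) (queue_pmf s)"
  let ?c = "ennreal (x ^ (k + S)) * unsorted_prob (1 - s\<^sup>2) k t xs"
  have "ennreal (x ^ (k + S) * (e / (1 + e))) * unsorted_prob (1 - s\<^sup>2) k t xs = ?c * ennreal (e / (1 + e))"
    using x e by (subst ennreal_mult) (simp_all add: ac_simps)
  also have "\<dots> \<le> ?c * emeasure ?M {qs. sum_list qs \<le> S}"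
    by (intro mult_left_mono prob_sum_list_queue_ge s e S) simp
  also have "\<dots> = (\<integral>\<^sup>+qs. ?c * indicator {qs. sum_list qs \<le> S} qs \<partial>?M)"
    by (simp add: nn_integral_cmult_indicator)
  also have "\<dots> \<le> (\<integral>\<^sup>+qs. departure_gf s x t 0 qs \<partial>?M)"
  proof (intro nn_integral_mono_AE, unfold AE_measure_pmf_iff, intro ballI)
    fix qs assume qs: "qs \<in> set_pmf ?M"
    then show "?c * indicator {qs. sum_list qs \<le> S} qs \<le> departure_gf s x t 0 qs"
      using unsorted_prob_le_departure_gf[OF s x assms(6,7) _ dominates_start, of qs S t]
      by (auto simp: indicator_def set_replicate_pmf)
  qed
  also have "\<dots> = ennreal ((s + (1 - s) * x) ^ t)"
    using nn_integral_departure_gf[OF s x(1), where D = 0] by simp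
  finally show ?thesis .
qed

section \<open>Expected time\<close>

lemma coin_sum_const:
  "0 \<le> p \<Longrightarrow> p \<le> 1 \<Longrightarrow> finite I \<Longrightarrow> coin_sum p I (\<lambda>C. c) = c"
  using coin_sum_restrict[of p I "{}" "\<lambda>_. c"] by simp

lemma finite_perms [simp]: "finite (perms n)"
  by (simp add: perms_def)

lemma ungar_trans_nonneg: "0 \<le> p \<Longrightarrow> p \<le> 1 \<Longrightarrow> 0 \<le> ungar_trans p xs ys"
  by (auto simp: ungar_trans_def intro!: sum_nonneg)

lemma ungar_dist_nonneg: "0 \<le> p \<Longrightarrow> p \<le> 1 \<Longrightarrow> 0 \<le> ungar_dist p n t xs"
  by (induction t arbitrary: xs) (auto intro!: sum_nonneg mult_nonneg_nonneg ungar_trans_nonneg)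

lemma sum_ungar_trans:
  assumes p: "0 \<le> p" "p \<le> 1" and xs: "xs \<in> perms n"
  shows "(\<Sum>ys\<in>perms n. ennreal (ungar_trans p xs ys) * g ys)
    = coin_sum p (descents xs) (\<lambda>T. g (ungar_move xs T))"
proof -
  let ?w = "\<lambda>T. p ^ card T * (1 - p) ^ (card (descents xs) - card T)"
  have "ennreal (ungar_trans p xs ys)
      = (\<Sum>T\<in>Pow (descents xs). ennreal (if ungar_move xs T = ys then ?w T else 0))" for ys
    unfolding ungar_trans_def using p by (intro sum_ennreal[symmetric]) simp
  then have "ennreal (ungar_trans p xs ys) * g ys
      = (\<Sum>T\<in>Pow (descents xs). if ys = ungar_move xs T then ennreal (?w T) * g ys else 0)" for ys
    by (auto simp: sum_distrib_right intro!: sum.cong)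
  then have "(\<Sum>ys\<in>perms n. ennreal (ungar_trans p xs ys) * g ys)
      = (\<Sum>T\<in>Pow (descents xs). \<Sum>ys\<in>perms n. if ys = ungar_move xs T then ennreal (?w T) * g ys else 0)"
    by (simp only: sum.swap[of _ "Pow (descents xs)"])
  also have "\<dots> = coin_sum p (descents xs) (\<lambda>T. g (ungar_move xs T))"
    using ungar_move_in_perms[OF xs] by (simp add: coin_sum_def)
  finally show ?thesis .
qed

lemma sum_ungar_dist_Suc:
  assumes p: "0 \<le> p" "p \<le> 1"
  shows "(\<Sum>ys\<in>perms n. ennreal (ungar_dist p n (Suc t) ys) * g ys)
    = (\<Sum>xs\<in>perms n. ennreal (ungar_dist p n t xs) * coin_sum p (descents xs) (\<lambda>T. g (ungar_move xs T)))"
proof -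
  have "ennreal (ungar_dist p n (Suc t) ys) * g ys
      = (\<Sum>xs\<in>perms n. ennreal (ungar_dist p n t xs) * (ennreal (ungar_trans p xs ys) * g ys))" for ys
    using ungar_dist_nonneg[OF p] ungar_trans_nonneg[OF p]
    by (simp add: sum_distrib_left ac_simps flip: ennreal_mult sum_ennreal)
  then have "(\<Sum>ys\<in>perms n. ennreal (ungar_dist p n (Suc t) ys) * g ys)
      = (\<Sum>ys\<in>perms n. \<Sum>xs\<in>perms n. ennreal (ungar_dist p n t xs) * (ennreal (ungar_trans p xs ys) * g ys))"
    by (simp only:)
  also have "\<dots> = (\<Sum>xs\<in>perms n. ennreal (ungar_dist p n t xs) * (\<Sum>ys\<in>perms n. ennreal (ungar_trans p xs ys) * g ys))"
    unfolding sum_distrib_left by (rule sum.swap)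
  finally show ?thesis
    by (simp add: sum_ungar_trans[OF p] del: ungar_dist.simps)
qed

lemma rev_upt_in_perms: "rev [1..<Suc n] \<in> perms n"
  unfolding perms_def by (rule permutations_of_setI) (auto simp del: upt_Suc)

lemma sum_ungar_dist_0: "(\<Sum>xs\<in>perms n. ennreal (ungar_dist p n 0 xs) * g xs) = g (rev [1..<Suc n])"
proof -
  have "(\<Sum>xs\<in>perms n. ennreal (ungar_dist p n 0 xs) * g xs)
      = (\<Sum>xs\<in>perms n. if xs = rev [1..<Suc n] then g xs else 0)"
    by (intro sum.cong) (auto simp del: upt_Suc)
  then show ?thesis
    using rev_upt_in_perms[of n] by (simp del: upt_Suc)
qed

lemma sum_ungar_dist:
  assumes "0 \<le> p" "p \<le> 1"
  shows "(\<Sum>xs\<in>perms n. ennreal (ungar_dist p n t xs)) = 1"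
proof (induction t)
  case 0
  then show ?case
    using sum_ungar_dist_0[of p n "\<lambda>_. 1"] by simp
next
  case (Suc t)
  then show ?case
    using sum_ungar_dist_Suc[OF assms, of n t "\<lambda>_. 1"] assms by (simp add: coin_sum_const del: ungar_dist.simps)
qed

text \<open>Each induction step trades a forward step of \<open>ungar_dist\<close> for a backward
  step of \<open>unsorted_prob\<close>.\<close>

lemma sum_ungar_dist_unsorted:
  assumes "0 \<le> p" "p \<le> 1"
  shows "(\<Sum>xs\<in>perms n. ennreal (ungar_dist p n t xs) * unsorted_prob p k j xs)
    = unsorted_prob p k (t + j) (rev [1..<Suc n])"
proof (induction t arbitrary: j)
  case 0
  then show ?case
    using sum_ungar_dist_0 by simp
next
  case (Suc t)
  then show ?case
    using sum_ungar_dist_Suc[OF assms] Suc.IH[of "Suc j"] by (simp del: ungar_dist.simps upt_Suc)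
qed

lemma not_identity_prob_le:
  assumes "0 \<le> p" "p \<le> 1"
  shows "ennreal (\<Sum>xs\<in>perms n - {[1..<Suc n]}. ungar_dist p n t xs)
    \<le> (\<Sum>k<n. unsorted_prob p k t (rev [1..<Suc n]))"
proof -
  let ?d = "\<lambda>xs. ennreal (ungar_dist p n t xs)"
  have "ennreal (\<Sum>xs\<in>perms n - {[1..<Suc n]}. ungar_dist p n t xs) = (\<Sum>xs\<in>perms n - {[1..<Suc n]}. ?d xs)"
    using ungar_dist_nonneg[OF assms] by (simp add: sum_ennreal)
  also have "\<dots> \<le> (\<Sum>xs\<in>perms n - {[1..<Suc n]}. ?d xs * (\<Sum>k<n. unsorted_prob p k 0 xs))"
  proof (rule sum_mono)
    fix xs assume xs: "xs \<in> perms n - {[1..<Suc n]}"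
    then obtain k where k: "k < n" "small_count k xs k < k"
      using perms_eq_identityI[of xs n] by (metis DiffD1 DiffD2 insertI1 not_le)
    then have "1 \<le> unsorted_prob p k 0 xs"
      by simp
    also have "\<dots> \<le> (\<Sum>k<n. unsorted_prob p k 0 xs)"
      using k by (intro member_le_sum) auto
    finally show "?d xs \<le> ?d xs * (\<Sum>k<n. unsorted_prob p k 0 xs)"
      using mult_left_mono[of 1 "\<Sum>k<n. unsorted_prob p k 0 xs" "?d xs"] by simp
  qed
  also have "\<dots> \<le> (\<Sum>xs\<in>perms n. ?d xs * (\<Sum>k<n. unsorted_prob p k 0 xs))"
    by (intro sum_mono2) auto
  also have "\<dots> = (\<Sum>k<n. \<Sum>xs\<in>perms n. ?d xs * unsorted_prob p k 0 xs)"
    unfolding sum_distrib_left by (rule sum.swap)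
  also have "\<dots> = (\<Sum>k<n. unsorted_prob p k t (rev [1..<Suc n]))"
    using sum_ungar_dist_unsorted[OF assms, of n t _ 0] by (simp only: add_0_right)
  finally show ?thesis .
qed

section \<open>Exponential tail bounds and the choice of constants\<close>

lemma convex_combination_bounds:
  fixes s x :: real
  assumes "0 < s" "s < 1" "0 < x" "x < 1"
  shows "0 < s + (1 - s) * x" "s + (1 - s) * x < 1"
proof -
  show "0 < s + (1 - s) * x"
    using assms by (intro add_pos_pos mult_pos_pos) auto
  have "1 - (s + (1 - s) * x) = (1 - s) * (1 - x)"
    by (simp add: algebra_simps)
  moreover have "0 < (1 - s) * (1 - x)"
    using assms by simp
  ultimately show "s + (1 - s) * x < 1"
    by linarith
qed

text \<open>Taking for \<open>S\<close> the integer part of \<open>(1 + e) * (n - k)\<close> gives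
  \<open>k + S \<le> (1 + e) * n\<close> for every \<open>k\<close>, so the bound is uniform in the
  threshold.\<close>

lemma unsorted_prob_le_geometric:
  assumes s: "0 < s" "s < 1" and x: "0 < x" "x \<le> 1" and e: "0 < e" and "k \<le> n" "xs \<in> perms n"
  shows "unsorted_prob (1 - s\<^sup>2) k t xs
    \<le> ennreal ((1 + e) / e * x powr (- (1 + e) * n) * (s + (1 - s) * x) ^ t)"
proof -
  define S where "S = nat \<lfloor>(1 + e) * real (n - k)\<rfloor>"
  have S: "(1 + e) * real (n - k) < real S + 1" "real S \<le> (1 + e) * real (n - k)"
    using e unfolding S_def by (auto simp: of_nat_nat)
  let ?u = "unsorted_prob (1 - s\<^sup>2) k t xs" and ?b = "(s + (1 - s) * x) ^ t"
  define A where "A = x ^ (k + S) * (e / (1 + e))"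
  have A: "0 < A"
    using x e by (simp add: A_def)
  have b: "0 \<le> ?b"
    using s x by simp
  have "?u = ennreal (1 / A) * (ennreal A * ?u)"
    using A by (simp flip: mult.assoc ennreal_mult)
  also have "\<dots> \<le> ennreal (1 / A) * ennreal ?b"
    unfolding A_def using unsorted_prob_bound[OF s _ x(2) e assms(6,7) S(1)] x
    by (intro mult_left_mono) auto
  also have "\<dots> = ennreal (1 / A * ?b)"
    using A b by (simp flip: ennreal_mult)
  also have "\<dots> \<le> ennreal ((1 + e) / e * x powr (- (1 + e) * n) * ?b)"
  proof (intro ennreal_leI mult_right_mono b)
    have "real (k + S) \<le> real k + (1 + e) * real (n - k)"
      using S(2) by simp
    also have "\<dots> \<le> (1 + e) * n"
      using e \<open>k \<le> n\<close> by (simp add: algebra_simps of_nat_diff)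
    finally have "x powr ((1 + e) * n) \<le> x powr real (k + S)"
      using x by (intro powr_mono') auto
    then have "x powr ((1 + e) * n) \<le> x ^ (k + S)"
      using x by (simp only: powr_realpow)
    then have "1 / x ^ (k + S) \<le> x powr (- (1 + e) * n)"
      using x unfolding minus_mult_left[symmetric] powr_minus_divide by (intro frac_le) auto
    then have "(1 + e) / e * (1 / x ^ (k + S)) \<le> (1 + e) / e * x powr (- (1 + e) * n)"
      using e by (intro mult_left_mono) auto
    then show "1 / A \<le> (1 + e) / e * x powr (- (1 + e) * n)"
      by (simp add: A_def ac_simps)
  qed
  finally show ?thesis .
qed

text \<open>Tail probabilities are bounded by 1 before time \<open>t0\<close>, and from then on by
  the sum of \<open>n\<close> geometric bounds, one per threshold.\<close>

lemma expected_ungar_time_le: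
  assumes s: "0 < s" "s < 1" and x: "0 < x" "x < 1" and e: "0 < e"
  defines "b \<equiv> s + (1 - s) * x"
  shows "expected_ungar_time (1 - s\<^sup>2) n
    \<le> ennreal (real t0 + n * ((1 + e) / e) / (1 - b) * (x powr (- (1 + e) * n) * b ^ t0))"
proof -
  let ?p = "1 - s\<^sup>2"
  define K where "K = n * ((1 + e) / e) * x powr (- (1 + e) * n)"
  define c where "c = (\<lambda>t. if t < t0 then 1 else K * b ^ t)"
  let ?a = "\<lambda>t. \<Sum>xs\<in>perms n - {[1..<Suc n]}. ungar_dist ?p n t xs"
  have p: "0 \<le> ?p" "?p \<le> 1"
    using s by (auto simp: power_le_one)
  have K: "0 \<le> K"
    using e by (simp add: K_def)
  have b: "0 < b" "b < 1"
    unfolding b_def using convex_combination_bounds[OF s x] .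
  have a_le: "ennreal (?a t) \<le> ennreal (c t)" for t
  proof (cases "t < t0")
    case True
    have "ennreal (?a t) = (\<Sum>xs\<in>perms n - {[1..<Suc n]}. ennreal (ungar_dist ?p n t xs))"
      using ungar_dist_nonneg[OF p] by (intro sum_ennreal[symmetric]) auto
    also have "\<dots> \<le> (\<Sum>xs\<in>perms n. ennreal (ungar_dist ?p n t xs))"
      by (intro sum_mono2) auto
    also have "\<dots> = ennreal (c t)"
      using True sum_ungar_dist[OF p] by (simp add: c_def)
    finally show ?thesis .
  next
    case False
    have "ennreal (?a t) \<le> (\<Sum>k<n. unsorted_prob ?p k t (rev [1..<Suc n]))"
      by (rule not_identity_prob_le[OF p])
    also have "\<dots> \<le> (\<Sum>k<n. ennreal ((1 + e) / e * x powr (- (1 + e) * n) * b ^ t))"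
      unfolding b_def using x by (intro sum_mono unsorted_prob_le_geometric s e rev_upt_in_perms) auto
    also have "\<dots> = ennreal (c t)"
      using False e b by (simp add: c_def K_def ennreal_of_nat_eq_real_of_nat ac_simps flip: ennreal_mult)
    finally show ?thesis .
  qed
  have "(\<lambda>i. b ^ i) sums (1 / (1 - b))"
    using b by (intro geometric_sums) auto
  then have "(\<lambda>i. (K * b ^ t0) * b ^ i) sums ((K * b ^ t0) * (1 / (1 - b)))"
    by (rule sums_mult)
  then have "(\<lambda>i. c (i + t0)) sums ((K * b ^ t0) / (1 - b))"
    by (simp add: c_def power_add ac_simps)
  then have c: "c sums ((K * b ^ t0) / (1 - b) + real t0)"
    by (subst (asm) sums_iff_shift) (simp add: c_def)
  have "expected_ungar_time ?p n \<le> (\<Sum>t. ennreal (c t))"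
    unfolding expected_ungar_time_def by (intro suminf_le a_le summableI)
  also have "\<dots> = ennreal ((K * b ^ t0) / (1 - b) + real t0)"
    using c K b by (subst suminf_ennreal2) (auto simp: c_def sums_iff)
  finally show ?thesis
    by (simp add: K_def ac_simps)
qed

lemma expected_ungar_time_linear:
  assumes s: "0 < s" "s < 1" and e: "0 < e"
  shows "\<exists>C. \<forall>n. expected_ungar_time (1 - s\<^sup>2) n \<le> ennreal ((1 + 3 * e) / (1 - s) * n + C)"
proof -
  \<comment> \<open>For this \<open>x\<close>, \<open>1 / x - 1 = e / (1 + 2 * e)\<close> and
    \<open>1 - x = e / (1 + 3 * e)\<close>. Over \<open>t0\<close> steps the power of
    \<open>b\<close> gains \<open>exp (- e * n)\<close>, which beats the loss from the negative
    power of \<open>x\<close>.\<close>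
  define x where "x = (1 + 2 * e) / (1 + 3 * e)"
  define b where "b = s + (1 - s) * x"
  \<comment> \<open>The net decay rate, \<open>e - (1 + e) * (e / (1 + 2 * e))\<close>.\<close>
  define \<delta> where "\<delta> = e\<^sup>2 / (1 + 2 * e)"
  have x: "0 < x" "x < 1"
    using e by (auto simp: x_def field_simps)
  have \<delta>: "0 < \<delta>"
    using e by (simp add: \<delta>_def)
  have b: "0 < b" "b < 1"
    unfolding b_def using convex_combination_bounds[OF s x] .
  have decay: "x powr (- (1 + e) * n) * b ^ t0 \<le> exp (- \<delta> * n)"
    if t0: "(1 + 3 * e) / (1 - s) * n \<le> real t0" for n t0 :: nat
  proof -
    have "ln (1 / x) \<le> 1 / x - 1"
      using x by (intro ln_le_minus_one) auto
    then have "- ln x \<le> e / (1 + 2 * e)"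
      using e x by (simp add: ln_div x_def field_simps)
    then have "(1 + e) * n * (- ln x) \<le> (1 + e) * n * (e / (1 + 2 * e))"
      using e by (intro mult_left_mono) auto
    then have 1: "x powr (- (1 + e) * n) \<le> exp ((1 + e) * n * (e / (1 + 2 * e)))"
      using x by (simp add: powr_def algebra_simps)
    have nonzero: "1 - s \<noteq> 0" "1 + 3 * e \<noteq> 0"
      using s e by auto
    have "ln b \<le> b - 1"
      using b by (intro ln_le_minus_one) auto
    also have "b - 1 = - (1 - s) * (e / (1 + 3 * e))"
      using e by (simp add: b_def x_def field_simps)
    finally have "real t0 * ln b \<le> real t0 * (- (1 - s) * (e / (1 + 3 * e)))"
      by (intro mult_left_mono) auto
    also have "\<dots> = - (real t0 * ((1 - s) * (e / (1 + 3 * e))))"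
      by (simp only: mult_minus_left mult_minus_right)
    also have "\<dots> \<le> - ((1 + 3 * e) / (1 - s) * n * ((1 - s) * (e / (1 + 3 * e))))"
      using t0 s e by (intro le_imp_neg_le mult_right_mono) auto
    also have "\<dots> = - e * n"
      using s e by (simp add: nonzero)
    finally have 2: "b ^ t0 \<le> exp (- e * n)"
      using b by (simp flip: powr_realpow add: powr_def)
    have "x powr (- (1 + e) * n) * b ^ t0 \<le> exp ((1 + e) * n * (e / (1 + 2 * e))) * exp (- e * n)"
      using b by (intro mult_mono 1 2) auto
    also have "\<dots> = exp (((1 + e) * (e / (1 + 2 * e)) - e) * n)"
      by (simp add: algebra_simps flip: exp_add)
    also have "(1 + e) * (e / (1 + 2 * e)) - e = - \<delta>"
      using e by (simp add: \<delta>_def field_simps power2_eq_square)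
    finally show ?thesis .
  qed
  define K where "K = (1 + e) / e / (1 - b)"
  have K: "0 \<le> K"
    using e b by (simp add: K_def)
  have "expected_ungar_time (1 - s\<^sup>2) n \<le> ennreal ((1 + 3 * e) / (1 - s) * n + (1 + K / \<delta>))" for n
  proof -
    define t0 where "t0 = nat \<lceil>(1 + 3 * e) / (1 - s) * n\<rceil>"
    have "0 \<le> (1 + 3 * e) / (1 - s) * n"
      using s e by simp
    then have t0: "(1 + 3 * e) / (1 - s) * n \<le> real t0" "real t0 \<le> (1 + 3 * e) / (1 - s) * n + 1"
      unfolding t0_def by linarith+
    \<comment> \<open>The exponential decay absorbs the factor \<open>n\<close> of the union bound
      into a constant.\<close>
    have "\<delta> * n \<le> exp (\<delta> * n)"
      using exp_ge_add_one_self[of "\<delta> * n"] by linarith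
    then have "n * exp (- \<delta> * n) \<le> 1 / \<delta>"
      using \<delta> by (simp add: exp_minus field_simps)
    then have "n * (x powr (- (1 + e) * n) * b ^ t0) \<le> 1 / \<delta>"
      using mult_left_mono[OF decay[OF t0(1)], of "real n"] by linarith
    then have "K * (n * (x powr (- (1 + e) * n) * b ^ t0)) \<le> K * (1 / \<delta>)"
      using K by (rule mult_left_mono)
    then have "real t0 + n * ((1 + e) / e) / (1 - b) * (x powr (- (1 + e) * n) * b ^ t0)
        \<le> (1 + 3 * e) / (1 - s) * n + (1 + K / \<delta>)"
      using t0(2) by (simp add: K_def ac_simps)
    then show ?thesis
      using expected_ungar_time_le[OF s x e, of n t0] unfolding b_def
      by (meson ennreal_leI order_trans)
  qed
  then show ?thesis by blast
qed

theorem theorem1p3: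
  fixes p :: real
  assumes "0 < p" and "p < 1"
  shows "\<exists>f :: nat \<Rightarrow> real. f \<in> o(\<lambda>n. real n) \<and>
           (\<forall>n. expected_ungar_time p n
                  \<le> ennreal ((1 + sqrt (1 - p)) / p * real n + f n))"
proof -
  define s where "s = sqrt (1 - p)"
  have s: "0 < s" "s < 1" and p: "p = 1 - s\<^sup>2"
    using assms by (auto simp: s_def)
  define c where "c = (1 + sqrt (1 - p)) / p"
  have "p = (1 - s) * (1 + s)"
    by (simp add: p power2_eq_square algebra_simps)
  then have c_eq: "c = 1 / (1 - s)"
    using s unfolding c_def s_def[symmetric] by simp
  have c: "0 < c"
    using s by (simp add: c_eq)
  define E where "E = expected_ungar_time p"
  have lin: "\<exists>C. \<forall>n. E n \<le> ennreal ((1 + 3 * e) * c * n + C)" if "0 < e" for e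
    using expected_ungar_time_linear[OF s that] by (simp add: E_def p c_eq)
  \<comment> \<open>The excess over the linear term, cut off at 0.\<close>
  define f where "f = (\<lambda>n. max 0 (enn2real (E n) - c * n))"
  have "f \<in> o(\<lambda>n. real n)"
  proof (rule landau_o.smallI)
    fix r :: real assume r: "0 < r"
    \<comment> \<open>With this \<open>e\<close> the surplus \<open>3 * e * c * n\<close> is
      \<open>r / 2 * n\<close>; the other half of \<open>r * n\<close> absorbs the constant
      \<open>C\<close> for large \<open>n\<close>.\<close>
    define e where "e = r / (6 * c)"
    have e: "0 < e"
      using r c by (simp add: e_def)
    obtain C where C: "\<And>n. E n \<le> ennreal ((1 + 3 * e) * c * n + C)"
      using lin[OF e] by blast
    have "\<forall>\<^sub>F n :: nat in sequentially. \<bar>C\<bar> * 2 / r \<le> n"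
      by (rule eventually_sequentiallyI[of "nat \<lceil>\<bar>C\<bar> * 2 / r\<rceil>"]) linarith
    then show "\<forall>\<^sub>F n in sequentially. norm (f n) \<le> r * norm (real n)"
    proof eventually_elim
      case (elim n)
      have pos: "0 \<le> (1 + 3 * e) * c * n"
        using e c by simp
      have "E n \<le> ennreal ((1 + 3 * e) * c * n + \<bar>C\<bar>)"
        using C[of n] by (rule order_trans) (simp add: ennreal_leI)
      then have "enn2real (E n) \<le> (1 + 3 * e) * c * n + \<bar>C\<bar>"
        using pos by (intro enn2real_leI) auto
      also have "\<dots> = c * n + r / 2 * n + \<bar>C\<bar>"
        using c by (simp add: e_def field_simps)
      also have "\<bar>C\<bar> \<le> r / 2 * n"
        using elim r by (simp add: field_simps)
      finally have "enn2real (E n) - c * n \<le> r * n"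
        by (simp add: field_simps)
      then show ?case
        using r by (simp add: f_def)
    qed
  qed
  moreover have "E n \<le> ennreal (c * n + f n)" for n
  proof -
    \<comment> \<open>The expected time is finite, so \<open>enn2real\<close> returns its true value
      rather than the default at infinity.\<close>
    obtain C where "E n \<le> ennreal C"
      using lin[of 1] by auto
    then have "E n = ennreal (enn2real (E n))"
      by (metis ennreal_enn2real ennreal_less_top order_le_less_trans)
    also have "\<dots> \<le> ennreal (c * n + f n)"
      by (rule ennreal_leI) (simp add: f_def)
    finally show ?thesis .
  qed
  ultimately show ?thesis
    unfolding E_def c_def by blast
qed

end
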